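(* Let $\alpha:I\to\mathbb{E}^3$ be a regular curve parameterized by arc-length, with nowhere vanishing curvature so that its Frenet frame $\{\mathbf{t},\mathbf{n},\mathbf{b}\}$ is defined. Then $\alpha$ is a slant helix if and only if its natural mate is a general helix.
   Context: $\mathbb{E}^3$ is $\mathbb{R}^3$ with the standard Euclidean inner product and $I\subset\mathbb{R}$ is an interval. The natural mate of $\alpha$ is the curve $\beta(s)=\int\mathbf{n}(u)\,\mathrm{d}u$, i.e., the curve (unique up to translation) with unit tangent $\mathbf{t}_\beta=\mathbf{n}$, where $\mathbf{n}$ is the principal normal of $\alpha$. A curve is a slant helix if its principal normal makes a constant angle with a fixed direction (a fixed unit vector). A curve is a general helix if its unit tangent makes a constant angle with a fixed direction. *)

theory Defs
  imports "HOL-Analysis.Analysis"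
begin

text \<open>
  A curve is a function on the reals, considered only on an interval \<open>I\<close>, which may be open,
  half-open or closed, bounded or not. All derivatives are taken within \<open>I\<close>, so they are one-sided
  at an end point belonging to \<open>I\<close>, and the values of the function outside \<open>I\<close> are irrelevant.
\<close>

definition velocity :: "real set \<Rightarrow> (real \<Rightarrow> real^3) \<Rightarrow> real \<Rightarrow> real^3" where
  "velocity I \<gamma> s = vector_derivative \<gamma> (at s within I)"

text \<open>
  Twice continuous differentiability is the least smoothness for which the principal normal is
  defined and continuous, hence integrable; in particular all smooth curves are covered.
\<close>

definition regular_curve :: "real set \<Rightarrow> (real \<Rightarrow> real^3) \<Rightarrow> bool" where
  "regular_curve I \<gamma> \<longleftrightarrow>
     \<gamma> differentiable_on I \<and>
     velocity I \<gamma> differentiable_on I \<and>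
     continuous_on I (velocity I (velocity I \<gamma>)) \<and>
     (\<forall>s\<in>I. velocity I \<gamma> s \<noteq> 0)"

definition arc_length_parameterized :: "real set \<Rightarrow> (real \<Rightarrow> real^3) \<Rightarrow> bool" where
  "arc_length_parameterized I \<gamma> \<longleftrightarrow> (\<forall>s\<in>I. norm (velocity I \<gamma> s) = 1)"

text \<open>
  The next three definitions make sense for any regular parameterization. For a curve
  parameterized by arc length they reduce to \<open>t = \<gamma>'\<close>, \<open>\<kappa> = \<parallel>t'\<parallel>\<close> and \<open>n = t' / \<kappa>\<close>.
\<close>

definition unit_tangent :: "real set \<Rightarrow> (real \<Rightarrow> real^3) \<Rightarrow> real \<Rightarrow> real^3" where
  "unit_tangent I \<gamma> s = velocity I \<gamma> s /\<^sub>R norm (velocity I \<gamma> s)"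

definition curvature :: "real set \<Rightarrow> (real \<Rightarrow> real^3) \<Rightarrow> real \<Rightarrow> real" where
  "curvature I \<gamma> s = norm (velocity I (unit_tangent I \<gamma>) s) / norm (velocity I \<gamma> s)"

definition principal_normal :: "real set \<Rightarrow> (real \<Rightarrow> real^3) \<Rightarrow> real \<Rightarrow> real^3" where
  "principal_normal I \<gamma> s =
     velocity I (unit_tangent I \<gamma>) s /\<^sub>R norm (velocity I (unit_tangent I \<gamma>) s)"

definition vec_angle :: "real^3 \<Rightarrow> real^3 \<Rightarrow> real" where
  "vec_angle v w = arccos ((v \<bullet> w) / (norm v * norm w))"

definition constant_angle_with_fixed_direction :: "real set \<Rightarrow> (real \<Rightarrow> real^3) \<Rightarrow> bool" where
  "constant_angle_with_fixed_direction I V \<longleftrightarrow>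
     (\<exists>d. norm d = 1 \<and> (\<exists>\<theta>. \<forall>s\<in>I. vec_angle (V s) d = \<theta>))"

definition general_helix :: "real set \<Rightarrow> (real \<Rightarrow> real^3) \<Rightarrow> bool" where
  "general_helix I \<gamma> \<longleftrightarrow> constant_angle_with_fixed_direction I (unit_tangent I \<gamma>)"

definition slant_helix :: "real set \<Rightarrow> (real \<Rightarrow> real^3) \<Rightarrow> bool" where
  "slant_helix I \<gamma> \<longleftrightarrow> constant_angle_with_fixed_direction I (principal_normal I \<gamma>)"

text \<open>
  The natural mate \<open>\<beta>(s) = \<integral> n(u) du\<close> is an indefinite integral and hence only determined up to
  translation. The base point \<open>s\<^sub>0\<close> and the initial position \<open>p = \<beta>(s\<^sub>0)\<close> record this freedom. The
  integral is oriented, so it is also the right one for \<open>s < s\<^sub>0\<close>.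
\<close>

definition natural_mate ::
    "real set \<Rightarrow> real \<Rightarrow> real^3 \<Rightarrow> (real \<Rightarrow> real^3) \<Rightarrow> real \<Rightarrow> real^3" where
  "natural_mate I s\<^sub>0 p \<alpha> s = p + (LBINT u=s\<^sub>0..s. principal_normal I \<alpha> u)"

end

theory Submission
  imports Defs
begin

text \<open>
  The integrand \<open>n\<close> is continuous, so the mate has velocity \<open>n\<close>, which is a unit vector: the unit
  tangent of the mate is the principal normal of the curve, and both sides of the equivalence
  become the same condition.
\<close>

text \<open>\<open>vector_derivative\<close> is a choice, determined only where the filter is
  nontrivial. A connected set other than a singleton has no isolated points.\<close>

lemma is_interval_at_within_neq_bot:
  fixes I :: "real set"
  assumes "is_interval I" "interior I \<noteq> {}" "x \<in> I"
  shows "at x within I \<noteq> bot"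
proof -
  have "I \<noteq> {y}" for y
    using assms(2) by auto
  moreover have "connected I"
    using assms(1) by (simp add: is_interval_connected)
  ultimately show ?thesis
    using assms(3) connected_imp_perfect[of I x] trivial_limit_within[of x I] by auto
qed

lemma velocity_cong:
  assumes "\<And>u. u \<in> I \<Longrightarrow> \<gamma> u = \<delta> u" "s \<in> I"
  shows "velocity I \<gamma> s = velocity I \<delta> s"
  unfolding velocity_def by (rule vector_derivative_cong_eq) (use assms in auto)

lemma norm_principal_normal:
  assumes "curvature I \<gamma> s \<noteq> 0"
  shows "norm (principal_normal I \<gamma> s) = 1"
  using assms by (auto simp: curvature_def principal_normal_def)

text \<open>At unit speed the unit tangent is the velocity on \<open>I\<close>, so the numerator of
  the normal is the second derivative of the curve, continuous by regularity; nonzero curvature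
  keeps the denominator away from 0.\<close>

lemma continuous_on_principal_normal:
  assumes "regular_curve I \<gamma>" "arc_length_parameterized I \<gamma>"
    and "\<forall>s\<in>I. curvature I \<gamma> s \<noteq> 0"
  shows "continuous_on I (principal_normal I \<gamma>)"
proof -
  have "velocity I (unit_tangent I \<gamma>) s = velocity I (velocity I \<gamma>) s" if "s \<in> I" for s
    using assms(2) that
    by (intro velocity_cong) (auto simp: unit_tangent_def arc_length_parameterized_def)
  then have "continuous_on I (velocity I (unit_tangent I \<gamma>))"
    using assms(1) by (simp add: regular_curve_def cong: continuous_on_cong)
  moreover have "\<forall>s\<in>I. norm (velocity I (unit_tangent I \<gamma>) s) \<noteq> 0"
    using assms(3) by (auto simp: curvature_def)
  ultimately show ?thesis
    unfolding principal_normal_def by (intro continuous_intros) auto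
qed

lemma has_vector_derivative_LBINT_within_interval:
  fixes f :: "real \<Rightarrow> 'a::euclidean_space" and c x :: real
  assumes "is_interval I" "continuous_on I f" "c \<in> I" "x \<in> I"
  shows "((\<lambda>u. LBINT y=c..u. f y) has_vector_derivative f x) (at x within I)"
proof -
  \<comment> \<open>A compact subinterval \<open>{a..b}\<close> containing \<open>c\<close> that is a neighbourhood of \<open>x\<close> relative to \<open>I\<close>.\<close>
  obtain a l where a: "a \<in> I" "a \<le> c" "a \<le> x" "l < x" "\<And>y. y \<in> I \<Longrightarrow> l < y \<Longrightarrow> a \<le> y"
  proof (cases "\<exists>y\<in>I. y < x")
    case True
    then obtain y where "y \<in> I" "y < x" by blast
    then show ?thesis
      using assms(3) by (intro that[of "min y c" "min y c"]) (auto simp: min_def)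
  next
    \<comment> \<open>Here \<open>x\<close> is the least point of \<open>I\<close>, so
      \<open>x\<close> itself serves as \<open>a\<close>, and any number below \<open>x\<close>
      serves as \<open>l\<close>.\<close>
    case False
    then show ?thesis
      using assms(3,4) by (intro that[of x "x - 1"]) (auto simp: not_less)
  qed
  obtain b r where b: "b \<in> I" "c \<le> b" "x \<le> b" "x < r" "\<And>y. y \<in> I \<Longrightarrow> y < r \<Longrightarrow> y \<le> b"
  proof (cases "\<exists>y\<in>I. x < y")
    case True
    then obtain y where "y \<in> I" "x < y" by blast
    then show ?thesis
      using assms(3) by (intro that[of "max y c" "max y c"]) (auto simp: max_def)
  next
    case False
    then show ?thesis
      using assms(3,4) by (intro that[of x "x + 1"]) (auto simp: not_less)
  qed
  have sub: "{a..b} \<subseteq> I"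
    using assms(1) a(1) b(1) by (meson atLeastAtMost_iff is_interval_1 subsetI)
  \<comment> \<open>Inside the open window from \<open>l\<close> to \<open>r\<close> around
    \<open>x\<close>, the sets \<open>I\<close> and \<open>{a..b}\<close> coincide, and a derivative
    at \<open>x\<close> sees only such a window.\<close>
  have "at x within I = at x within {a..b}"
    by (rule at_within_nhd[where S = "{l<..<r}"]) (use a b sub in auto)
  then show ?thesis
    using interval_integral_FTC2[of a c b f x] a b continuous_on_subset[OF assms(2) sub] by simp
qed

lemma velocity_natural_mate:
  assumes "is_interval I" "interior I \<noteq> {}" "s\<^sub>0 \<in> I" "s \<in> I"
    and "continuous_on I (principal_normal I \<alpha>)"
  shows "velocity I (natural_mate I s\<^sub>0 p \<alpha>) s = principal_normal I \<alpha> s"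
proof -
  \<comment> \<open>The summand 0 is the derivative of the constant \<open>p\<close>, kept so that
    the sum rule applies literally.\<close>
  have "((\<lambda>s. p + (LBINT u=s\<^sub>0..s. principal_normal I \<alpha> u))
      has_vector_derivative 0 + principal_normal I \<alpha> s) (at s within I)"
    by (intro has_vector_derivative_add has_vector_derivative_const
        has_vector_derivative_LBINT_within_interval assms)
  then show ?thesis
    unfolding velocity_def natural_mate_def[abs_def]
    using is_interval_at_within_neq_bot[OF assms(1,2,4)] by (simp add: vector_derivative_within)
qed

theorem theorem5p2:
  fixes I :: "real set" and \<alpha> :: "real \<Rightarrow> real^3" and s\<^sub>0 :: real and p :: "real^3"
  assumes "is_interval I" and "interior I \<noteq> {}"
    and "regular_curve I \<alpha>"
    and "arc_length_parameterized I \<alpha>"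
    and "\<forall>s\<in>I. curvature I \<alpha> s \<noteq> 0"
    and "s\<^sub>0 \<in> I"
  shows "slant_helix I \<alpha> \<longleftrightarrow> general_helix I (natural_mate I s\<^sub>0 p \<alpha>)"
proof -
  have "unit_tangent I (natural_mate I s\<^sub>0 p \<alpha>) s = principal_normal I \<alpha> s" if "s \<in> I" for s
    using assms that
    by (simp add: unit_tangent_def velocity_natural_mate continuous_on_principal_normal
        norm_principal_normal)
  \<comment> \<open>Agreement on \<open>I\<close> suffices, because the angle condition looks only
    at parameters in \<open>I\<close>.\<close>
  then show ?thesis
    by (simp add: slant_helix_def general_helix_def constant_angle_with_fixed_direction_def)
qed

end
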